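(* Let $p$ be a prime and $\mathbb{F}=\mathbb{F}_p$. There is a constant $\epsilon>0$, depending on $p$ but not on $N$, such that for every $N\ge 1$ the elementary symmetric polynomial $S_{2p}(x)=\sum_{T\subseteq[N],\,|T|=2p}\prod_{i\in T}x_i$, viewed as a function $\mathbb{F}^N\to\mathbb{F}$, satisfies $$\|S_{2p}\|_{U^{p+2}}>\epsilon .$$
   Context: For $f:\mathbb{F}_p^N\to\mathbb{F}_p$ and $y\in\mathbb{F}_p^N$, the directional derivative is $f_y(x)=f(x+y)-f(x)$, and iterated derivatives are $f_{y_1\dots y_k}=(f_{y_1\dots y_{k-1}})_{y_k}$. Let $e(a)=e^{2\pi i a/p}$ for $a\in\mathbb{F}_p$. The $k$-th Gowers norm is $\|f\|_{U^k}=\left(\mathbb{E}_{x,y_1,\dots,y_k\in\mathbb{F}_p^N}\, e\big(f_{y_1\dots y_k}(x)\big)\right)^{1/2^k}$ (the expectation is a nonnegative real). *)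

theory Defs
  imports "HOL-Analysis.Analysis"
begin

text \<open>Vectors of F_p^N are represented as functions nat => int whose coordinates
  i < N lie in {0..<p} and whose coordinates i >= N are 0. Elements of F_p are
  represented by integers; functions F_p^N -> F_p are int-valued, and only their
  residues mod p matter (through the character e).\<close>

definition Fvec :: "nat \<Rightarrow> nat \<Rightarrow> (nat \<Rightarrow> int) set" where
  "Fvec p N = {x. (\<forall>i<N. x i \<in> {0..<int p}) \<and> (\<forall>i\<ge>N. x i = 0)}"

definition vadd :: "nat \<Rightarrow> (nat \<Rightarrow> int) \<Rightarrow> (nat \<Rightarrow> int) \<Rightarrow> (nat \<Rightarrow> int)" where
  "vadd p x y = (\<lambda>i. (x i + y i) mod int p)"

definition echar :: "nat \<Rightarrow> int \<Rightarrow> complex" where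
  "echar p a = exp (2 * pi * \<i> * of_int a / of_nat p)"

definition dderiv :: "nat \<Rightarrow> ((nat \<Rightarrow> int) \<Rightarrow> int) \<Rightarrow> (nat \<Rightarrow> int) \<Rightarrow> (nat \<Rightarrow> int) \<Rightarrow> int" where
  "dderiv p f y = (\<lambda>x. (f (vadd p x y) - f x) mod int p)"

definition iter_deriv :: "nat \<Rightarrow> ((nat \<Rightarrow> int) \<Rightarrow> int) \<Rightarrow> (nat \<Rightarrow> int) list \<Rightarrow> (nat \<Rightarrow> int) \<Rightarrow> int" where
  "iter_deriv p f ys = foldl (\<lambda>g y. dderiv p g y) f ys"

definition gowers_norm :: "nat \<Rightarrow> nat \<Rightarrow> nat \<Rightarrow> ((nat \<Rightarrow> int) \<Rightarrow> int) \<Rightarrow> real" where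
  "gowers_norm p N k f =
     (Re ((\<Sum>x\<in>Fvec p N. \<Sum>ys\<in>{ys. length ys = k \<and> set ys \<subseteq> Fvec p N}.
              echar p (iter_deriv p f ys x))
          / of_nat (card (Fvec p N) ^ (k + 1)))) powr (1 / 2 ^ k)"

definition elem_sym :: "nat \<Rightarrow> nat \<Rightarrow> nat \<Rightarrow> (nat \<Rightarrow> int) \<Rightarrow> int" where
  "elem_sym p N d x = (\<Sum>T\<in>{T. T \<subseteq> {0..<N} \<and> card T = d}. \<Prod>i\<in>T. x i) mod int p"

end

theory Submission
  imports Defs "HOL-Number_Theory.Residues"
begin

text \<open>
  On \<open>A = {x. p dvd #{i. x i = a} for 0 < a < p, and p\<^sup>2 dvd \<Sum>i. x i}\<close>, the generating function
  \<open>\<Prod>i. (1 + x i t)\<close> is a \<open>p\<close>-th power, and comparing its coefficients by Frobenius and by Newton's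
  identity gives \<open>S\<^sub>2\<^sub>p(x)/p = S\<^sub>2(x)/p\<^sup>2\<close> modulo 1, where \<open>S\<^sub>2\<close> is evaluated at the integer
  representatives. The right-hand side is a nonclassical polynomial of degree \<open>p + 1\<close>, and \<open>A\<close> is
  cut out by nonclassical polynomials of degree at most \<open>p\<close>. Fourier expansion of the indicator
  of \<open>A\<close> therefore yields a nonclassical polynomial of degree at most \<open>p + 1\<close> whose phase correlates
  with that of \<open>S\<^sub>2\<^sub>p\<close> at least as much as the density of \<open>A\<close>. Such phases do not change the
  \<open>U\<^bsup>p+2\<^esup>\<close> norm, which dominates the absolute value of the mean. Finally, the density of \<open>A\<close> is
  bounded below because every vector can be moved into \<open>A\<close> by changing boundedly many coordinates.
\<close>

hide_const (open) up_ring.monom up_ring.coeff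

subsection \<open>Integer-valued functions with vanishing iterated derivatives\<close>

locale prime_vectors =
  fixes p N :: nat
  assumes prime_p: "prime p"
begin

abbreviation X :: "(nat \<Rightarrow> int) set" where "X \<equiv> Fvec p N"

lemma p_pos: "p > 0" and p_gt_1: "p > 1"
  using prime_p prime_gt_1_nat by (auto simp: prime_gt_0_nat)

lemma vadd_in [simp]: "x \<in> X \<Longrightarrow> y \<in> X \<Longrightarrow> vadd p x y \<in> X"
  using p_pos by (auto simp: Fvec_def vadd_def)

lemma coord_range: "x \<in> X \<Longrightarrow> x i \<in> {0..<int p}"
  using p_pos by (cases "i < N") (auto simp: Fvec_def)

definition diff :: "(nat \<Rightarrow> int) \<Rightarrow> ((nat \<Rightarrow> int) \<Rightarrow> int) \<Rightarrow> (nat \<Rightarrow> int) \<Rightarrow> int" where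
  "diff y u = (\<lambda>x. u (vadd p x y) - u x)"

text \<open>\<open>annih k m u\<close> says that \<open>u/m\<close> modulo 1 is a nonclassical polynomial of degree less than \<open>k\<close>.\<close>

primrec annih :: "nat \<Rightarrow> nat \<Rightarrow> ((nat \<Rightarrow> int) \<Rightarrow> int) \<Rightarrow> bool" where
  "annih 0 m u \<longleftrightarrow> (\<forall>x\<in>X. int m dvd u x)"
| "annih (Suc k) m u \<longleftrightarrow> (\<forall>y\<in>X. annih k m (diff y u))"

text \<open>All differences of \<open>v - u\<close> stay divisible by \<open>m\<close>. This allows
  an integer function to be traded for any polynomial that agrees with it modulo
  \<open>m\<close>.\<close>

lemma annih_cong_mod:
  assumes "annih k m u" "\<And>x. x \<in> X \<Longrightarrow> int m dvd v x - u x"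
  shows "annih k m v"
  using assms
proof (induction k arbitrary: u v)
  case 0
  then show ?case by (metis annih.simps(1) diff_add_cancel dvd_add)
next
  case (Suc k)
  have "annih k m (diff y v)" if y: "y \<in> X" for y
  proof (rule Suc.IH[of "diff y u"])
    show "annih k m (diff y u)" using Suc.prems(1) y by simp
    fix x assume x: "x \<in> X"
    have "diff y v x - diff y u x
        = (v (vadd p x y) - u (vadd p x y)) - (v x - u x)"
      by (simp add: diff_def)
    then show "int m dvd diff y v x - diff y u x"
      using Suc.prems(2) x y by (metis dvd_diff vadd_in)
  qed
  then show ?case by simp
qed

lemma annih_cong: "annih k m u \<Longrightarrow> (\<And>x. x \<in> X \<Longrightarrow> v x = u x) \<Longrightarrow> annih k m v"
  by (rule annih_cong_mod[of k m u]) auto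

lemma annih_add: "annih k m u \<Longrightarrow> annih k m v \<Longrightarrow> annih k m (\<lambda>x. u x + v x)"
proof (induction k arbitrary: u v)
  case (Suc k)
  have "diff y (\<lambda>x. u x + v x) = (\<lambda>x. diff y u x + diff y v x)" for y
    by (auto simp: diff_def)
  then show ?case using Suc by simp
qed auto

lemma annih_cmult: "annih k m u \<Longrightarrow> annih k m (\<lambda>x. c * u x)"
proof (induction k arbitrary: u)
  case (Suc k)
  have "diff y (\<lambda>x. c * u x) = (\<lambda>x. c * diff y u x)" for y
    by (auto simp: diff_def algebra_simps)
  then show ?case using Suc by simp
qed auto

text \<open>The phase \<open>u / m\<close> equals \<open>n * u / (n * m)\<close>; this lifts a
  degree bound modulo \<open>p\<close> to one modulo \<open>p * p\<close>.\<close>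

lemma annih_scale: "annih k m u \<Longrightarrow> annih k (n * m) (\<lambda>x. int n * u x)"
proof (induction k arbitrary: u)
  case (Suc k)
  have "diff y (\<lambda>x. int n * u x) = (\<lambda>x. int n * diff y u x)" for y
    by (auto simp: diff_def algebra_simps)
  then show ?case using Suc by simp
qed auto

lemma annih_const: "annih (Suc k) m (\<lambda>x. c)"
proof (induction k arbitrary: c)
  case (Suc k)
  then show ?case by (auto simp: diff_def)
qed (auto simp: diff_def)

lemma annih_zero: "annih k m (\<lambda>x. 0)"
  by (cases k) (auto simp: annih_const simp del: annih.simps(2))

lemma annih_sum: "(\<And>j. j \<in> J \<Longrightarrow> annih k m (u j)) \<Longrightarrow> annih k m (\<lambda>x. \<Sum>j\<in>J. u j x)"
  by (induction J rule: infinite_finite_induct) (auto simp: annih_zero annih_add)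

lemma annih_Suc: "annih k m u \<Longrightarrow> annih (Suc k) m u"
proof (induction k arbitrary: u)
  case 0
  then show ?case by (auto simp: diff_def)
next
  case (Suc k)
  then show ?case by (metis annih.simps(2))
qed

lemma annih_mono: "annih k m u \<Longrightarrow> k \<le> l \<Longrightarrow> annih l m u"
  by (rule dec_induct) (auto simp: annih_Suc simp del: annih.simps)

lemma annih_pred: "annih k m u \<Longrightarrow> y \<in> X \<Longrightarrow> annih (k - 1) m (diff y u)"
  by (cases k) (auto simp: diff_def)

lemma diff_mult:
  "diff y (\<lambda>x. u x * v x) = (\<lambda>x. (diff y u x * v x + u x * diff y v x) + diff y u x * diff y v x)"
  by (auto simp: diff_def algebra_simps)

text \<open>Degrees add under multiplication: degrees at most \<open>a - 1\<close> and
  \<open>b - 1\<close> give at most \<open>a + b - 2\<close>, whence the \<open>Suc c\<close>. The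
  discrete Leibniz rule has a third term, in which both factors are differentiated.\<close>

lemma annih_mult:
  assumes "annih a m u" "annih b m v" "a + b \<le> Suc c"
  shows "annih c m (\<lambda>x. u x * v x)"
  using assms
proof (induction c arbitrary: a b u v)
  case 0
  then have "a = 0 \<or> b = 0" by auto
  with 0 show ?case by auto
next
  case (Suc c)
  show ?case
  proof (cases "a = 0 \<or> b = 0")
    case True
    with Suc.prems have "annih 0 m (\<lambda>x. u x * v x)" by auto
    then show ?thesis by (rule annih_mono) simp
  next
    case False
    have "annih c m (diff y (\<lambda>x. u x * v x))" if y: "y \<in> X" for y
      unfolding diff_mult
      by (intro annih_add Suc.IH[of "a-1" _ b] Suc.IH[of a _ "b-1"] Suc.IH[of "a-1" _ "b-1"]
            annih_pred Suc.prems y) (use False Suc.prems in auto)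
    then show ?thesis by simp
  qed
qed

text \<open>In an iterated Leibniz expansion of the product every term has at least \<open>c\<close>
  derivatives, so either one factor is divisible by \<open>m\<^sup>2\<close> or both are divisible by \<open>m\<close>.\<close>

lemma annih_mult_square:
  assumes "annih a m u" "annih b (m\<^sup>2) u" "annih a' m v" "annih b' (m\<^sup>2) v"
    and "a' = 0 \<or> b + a' \<le> Suc c" "a = 0 \<or> a + b' \<le> Suc c"
  shows "annih c (m\<^sup>2) (\<lambda>x. u x * v x)"
  using assms
proof (induction c arbitrary: a b a' b' u v)
  case 0
  then have "b = 0 \<or> b' = 0 \<or> a = 0 \<and> a' = 0" by auto
  with 0 show ?case by (auto simp: power2_eq_square mult_dvd_mono)
next
  case (Suc c)
  show ?case
  proof (cases "b = 0 \<or> b' = 0 \<or> a = 0 \<and> a' = 0")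
    case True
    with Suc.prems have "annih 0 (m\<^sup>2) (\<lambda>x. u x * v x)"
      by (auto simp: power2_eq_square mult_dvd_mono)
    then show ?thesis by (rule annih_mono) simp
  next
    case False
    \<comment> \<open>Here \<open>b\<close> and \<open>b'\<close> are positive, so in each of the
      three Leibniz terms every nontrivial sum in the side conditions drops by at least one.\<close>
    have "annih c (m\<^sup>2) (diff y (\<lambda>x. u x * v x))" if y: "y \<in> X" for y
    proof -
      note pred = annih_pred[OF _ y]
      have "annih c (m\<^sup>2) (\<lambda>x. diff y u x * v x)"
        by (rule Suc.IH[OF pred pred, OF Suc.prems(1-4)]) (use False Suc.prems(5,6) in linarith)+
      moreover have "annih c (m\<^sup>2) (\<lambda>x. u x * diff y v x)"
        by (rule Suc.IH[OF _ _ pred pred, OF Suc.prems(1-4)]) (use False Suc.prems(5,6) in linarith)+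
      moreover have "annih c (m\<^sup>2) (\<lambda>x. diff y u x * diff y v x)"
        by (rule Suc.IH[OF pred pred pred pred, OF Suc.prems(1-4)])
          (use False Suc.prems(5,6) in linarith)+
      ultimately show ?thesis unfolding diff_mult by (intro annih_add)
    qed
    then show ?thesis by simp
  qed
qed

section \<open>Degrees of coordinates, level counts and the second symmetric function\<close>

lemma annih_power:
  assumes "annih 2 m u" shows "annih (Suc j) m (\<lambda>x. u x ^ j)"
proof (induction j)
  case 0
  show ?case using annih_const[of 0 m 1] by simp
next
  case (Suc j)
  show ?case using annih_mult[OF assms Suc.IH, of "Suc (Suc j)"] by simp
qed

lemma annih_coord: "annih 2 p (\<lambda>x. x i)"
proof -
  have "annih 1 p (diff y (\<lambda>x. x i))" for y
    unfolding One_nat_def by (rule annih_cong_mod[OF annih_const[of 0 p "y i"]])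
      (auto simp: diff_def vadd_def mod_eq_dvd_iff[symmetric] mod_diff_left_eq algebra_simps)
  then show ?thesis unfolding numeral_2_eq_2 One_nat_def by simp
qed

lemma fermat_int:
  assumes "\<not> int p dvd a"
  shows "[a ^ (p - 1) = 1] (mod int p)"
proof -
  define b where "b = nat (a mod int p)"
  have b: "int b = a mod int p" using p_pos by (simp add: b_def)
  then have "\<not> p dvd b" using assms by (metis dvd_mod_iff dvd_refl int_dvd_int_iff)
  then have "[int b ^ (p - 1) = 1] (mod int p)"
    using fermat_theorem[OF prime_p] by (metis cong_int_iff of_nat_1 of_nat_power)
  moreover have "[a ^ (p - 1) = int b ^ (p - 1)] (mod int p)"
    unfolding b by (intro cong_pow) (simp add: cong_def)
  ultimately show ?thesis by (rule cong_trans[rotated])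
qed

lemma fermat_int_pow_p: "int p dvd a ^ p - a"
proof (cases "int p dvd a")
  case True
  then show ?thesis using p_pos by (simp add: dvd_power_le dvd_diff dvd_power dvd_trans)
next
  case False
  have "a ^ p - a = a * (a ^ (p - 1) - 1)"
    using p_pos by (cases p) (auto simp: algebra_simps)
  then show ?thesis using fermat_int[OF False] by (simp add: cong_iff_dvd_diff)
qed

text \<open>By Fermat the indicator is \<open>1 - (x i - a) ^ (p - 1)\<close> modulo
  \<open>p\<close>, a polynomial of degree \<open>p - 1\<close>.\<close>

lemma annih_indicator: "a \<in> {0..<int p} \<Longrightarrow> annih p p (\<lambda>x. of_bool (x i = a))"
proof -
  assume a: "a \<in> {0..<int p}"
  have "annih 2 p (\<lambda>x. x i + - a)"
    by (intro annih_add annih_coord) (use annih_const[of 1 p "-a"] in \<open>simp add: numeral_2_eq_2\<close>)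
  from annih_power[OF this, of "p-1"] have "annih p p (\<lambda>x. (x i + - a) ^ (p-1))"
    using p_pos by simp
  then have "annih p p (\<lambda>x. 1 + (-1) * (x i + - a) ^ (p-1))"
    using annih_const[of "p-1" p 1] p_pos by (intro annih_add annih_cmult) auto
  then show ?thesis
  proof (rule annih_cong_mod)
    fix x assume x: "x \<in> X"
    show "int p dvd of_bool (x i = a) - (1 + (-1) * (x i + - a) ^ (p-1))"
    proof (cases "x i = a")
      case True
      then show ?thesis using p_gt_1 by (simp add: power_0_left)
    next
      case False
      have "\<not> int p dvd x i - a"
      proof
        assume "int p dvd x i - a"
        then show False using a False coord_range[OF x, of i]
          by (metis atLeastLessThan_iff mod_eq_dvd_iff mod_pos_pos_trivial)
      qed
      from fermat_int[OF this] False show ?thesis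
        by (simp add: cong_iff_dvd_diff)
    qed
  qed
qed

text \<open>The derivative of the integer representative is \<open>y i\<close> minus
  \<open>p\<close> times the carry of the addition. Modulo \<open>p\<close> the carry has degree at
  most \<open>p - 1\<close>, so \<open>x i / p^2\<close> has degree at most
  \<open>p\<close>.\<close>

lemma annih_coord_square: "annih (Suc p) (p\<^sup>2) (\<lambda>x. x i)"
proof -
  have "annih p (p\<^sup>2) (diff y (\<lambda>x. x i))" if y: "y \<in> X" for y
  proof (rule annih_cong)
    \<comment> \<open>The addition wraps around exactly when \<open>x i\<close> lies in
      \<open>{int p - y i..<int p}\<close>, so the carry is a sum of indicators.\<close>
    have "annih p (p * p) (\<lambda>x. int p * (\<Sum>a\<in>{int p - y i..<int p}. of_bool (x i = a)))"
      by (intro annih_scale annih_sum annih_indicator)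
        (use coord_range[OF y, of i] in auto)
    then show "annih p (p\<^sup>2) (\<lambda>x. y i + (-1) * (int p * (\<Sum>a\<in>{int p - y i..<int p}. of_bool (x i = a))))"
      using annih_const[of "p-1" "p\<^sup>2" "y i"] p_pos
      by (intro annih_add[OF _ annih_cmult]) (auto simp: power2_eq_square)
  next
    fix x assume x: "x \<in> X"
    note xi = coord_range[OF x, of i] and yi = coord_range[OF y, of i]
    have 1: "(\<Sum>a\<in>{int p - y i..<int p}. of_bool (x i = a)) = (of_bool (x i \<ge> int p - y i) :: int)"
      using xi by (simp add: of_bool_def sum.delta)
    have 2: "(x i + y i) mod int p = x i + y i - int p * of_bool (x i \<ge> int p - y i)"
    proof (cases "x i \<ge> int p - y i")
      case True
      have "(x i + y i) mod int p = (x i + y i - int p) mod int p" by simp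
      also have "\<dots> = x i + y i - int p" using xi yi True by (intro mod_pos_pos_trivial) auto
      finally show ?thesis using True by simp
    next
      case False
      then show ?thesis using xi yi by (simp add: mod_pos_pos_trivial)
    qed
    show "diff y (\<lambda>x. x i) x = y i + (-1) * (int p * (\<Sum>a\<in>{int p - y i..<int p}. of_bool (x i = a)))"
      unfolding 1 by (simp add: diff_def vadd_def 2)
  qed
  then show ?thesis by simp
qed

text \<open>Unlike \<open>elem_sym\<close> this is not reduced modulo \<open>p\<close>, because the
  residue of \<open>esym 2\<close> modulo \<open>p^2\<close> matters.\<close>

definition esym :: "nat \<Rightarrow> (nat \<Rightarrow> int) \<Rightarrow> int" where
  "esym d x = (\<Sum>T\<in>{T. T \<subseteq> {0..<N} \<and> card T = d}. \<Prod>i\<in>T. x i)"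

text \<open>Each factor of \<open>x i * x j\<close> has degree 1 modulo \<open>p\<close> and
  \<open>p\<close> modulo \<open>p^2\<close>, so the product has degree at most \<open>p + 1\<close>
  modulo \<open>p^2\<close>. This is what ties the argument to the norm of order
  \<open>p + 2\<close>.\<close>

lemma annih_esym_2: "annih (p + 2) (p\<^sup>2) (esym 2)"
proof -
  have "annih (p + 2) (p\<^sup>2) (\<lambda>x. \<Prod>i\<in>T. x i)" if "card T = 2" for T
  proof -
    from that obtain i j where T: "T = {i, j}" "i \<noteq> j" by (meson card_2_iff)
    have "annih (p + 2) (p\<^sup>2) (\<lambda>x. x i * x j)"
      by (rule annih_mult_square[OF annih_coord annih_coord_square annih_coord annih_coord_square]) auto
    then show ?thesis using T by simp
  qed
  then show ?thesis unfolding esym_def by (intro annih_sum) auto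
qed

definition level_count :: "int \<Rightarrow> (nat \<Rightarrow> int) \<Rightarrow> nat" where
  "level_count a x = card {i\<in>{0..<N}. x i = a}"

text \<open>The factor \<open>p\<close> turns divisibility of the count by \<open>p\<close> into
  divisibility by \<open>p^2\<close>, so that all conditions on balanced vectors share one
  modulus.\<close>

lemma annih_level_count:
  assumes "a \<in> {0..<int p}"
  shows "annih (p + 2) (p\<^sup>2) (\<lambda>x. int p * int (level_count a x))"
proof -
  have "annih p (p * p) (\<lambda>x. int p * (\<Sum>i\<in>{0..<N}. of_bool (x i = a)))"
    by (intro annih_scale annih_sum annih_indicator assms)
  then show ?thesis
    by (intro annih_mono[of p _ _ "p + 2"]) (simp_all add: level_count_def power2_eq_square Int_def)
qed

lemma annih_coord_sum: "annih (p + 2) (p\<^sup>2) (\<lambda>x. \<Sum>i\<in>{0..<N}. x i)"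
  by (intro annih_sum annih_mono[OF annih_coord_square]) auto

end

subsection \<open>Elementary symmetric functions of degree \<open>2\<close> and \<open>2p\<close>\<close>

lemma prod_monom_1: "(\<Prod>i\<in>T. monom (x i) (Suc 0)) = (monom (\<Prod>i\<in>T. x i) (card T) :: 'a::comm_semiring_1 poly)"
  by (induction T rule: infinite_finite_induct) (auto simp: mult_monom)

lemma coeff_prod_linear:
  assumes "finite A"
  shows "coeff (\<Prod>i\<in>A. [:1, x i:]) d = (\<Sum>T\<in>{T. T \<subseteq> A \<and> card T = d}. \<Prod>i\<in>T. x i :: 'a::comm_semiring_1)"
proof -
  have "(\<Prod>i\<in>A. [:1, x i:]) = (\<Prod>i\<in>A. monom (x i) (Suc 0) + 1)"
    by (simp add: monom_Suc monom_0 one_pCons)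
  also have "\<dots> = (\<Sum>T\<in>Pow A. monom (\<Prod>i\<in>T. x i) (card T))"
    by (simp add: prod_add assms prod_monom_1)
  finally have "coeff (\<Prod>i\<in>A. [:1, x i:]) d = (\<Sum>T\<in>Pow A. if card T = d then \<Prod>i\<in>T. x i else 0)"
    by (simp add: coeff_sum)
  also have "\<dots> = (\<Sum>T\<in>{T\<in>Pow A. card T = d}. \<Prod>i\<in>T. x i)"
    using assms by (subst sum.inter_filter) auto
  finally show ?thesis by (simp add: Pow_def)
qed

lemma coeff_pcompose_monom:
  fixes P :: "'a::comm_semiring_1 poly"
  assumes "n > 0"
  shows "coeff (pcompose P (monom 1 n)) (n * k) = coeff P k"
proof (induction P arbitrary: k)
  case (pCons a P)
  show ?case
  proof (cases k)
    case 0
    then show ?thesis using assms by (simp add: pcompose_pCons coeff_monom_mult)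
  next
    case (Suc j)
    then have "n * k = n + n * j" by simp
    then show ?thesis using assms pCons.IH[of j] Suc
      by (simp add: pcompose_pCons coeff_monom_mult coeff_pCons split: nat.splits)
  qed
qed simp

lemma pcompose_power: "pcompose (P ^ k) Q = pcompose (P :: 'a::comm_semiring_1 poly) Q ^ k"
  by (induction k) (auto simp: pcompose_1 pcompose_mult)

text \<open>By Newton's identity, \<open>s\<close> and \<open>r\<close> are the first two power sums of the \<open>c\<^sub>i\<close> if \<open>P = \<Prod>i. (1 + c\<^sub>i t)\<close>.\<close>

definition two_power_sums :: "int poly \<Rightarrow> int \<Rightarrow> int \<Rightarrow> bool" where
  "two_power_sums P s r \<longleftrightarrow> coeff P 0 = 1 \<and> coeff P 1 = s \<and> 2 * coeff P 2 = s\<^sup>2 - r"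

lemma two_power_sums_mult:
  assumes "two_power_sums P s r" "two_power_sums Q s' r'"
  shows "two_power_sums (P * Q) (s + s') (r + r')"
proof -
  have "coeff (P * Q) 1 = coeff P 0 * coeff Q 1 + coeff P 1 * coeff Q 0"
    by (simp add: coeff_mult)
  moreover have "coeff (P * Q) 2 = coeff P 0 * coeff Q 2 + coeff P 1 * coeff Q 1 + coeff P 2 * coeff Q 0"
    by (simp add: coeff_mult numeral_2_eq_2)
  ultimately show ?thesis
    \<comment> \<open>The middle term of \<open>coeff (P * Q) 2\<close> supplies the cross term of
      \<open>(s + s')^2\<close>, so the second power sums simply add.\<close>
    using assms by (simp add: two_power_sums_def coeff_mult_0 power2_eq_square algebra_simps)
qed

lemma two_power_sums_power: "two_power_sums ([:1, a:] ^ n) (a * int n) (a\<^sup>2 * int n)"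
proof (induction n)
  case 0
  show ?case by (simp add: two_power_sums_def)
next
  case (Suc n)
  have "two_power_sums [:1, a:] a (a\<^sup>2)"
    by (simp add: two_power_sums_def numeral_2_eq_2)
  from two_power_sums_mult[OF this Suc.IH] show ?case
    by (simp add: algebra_simps)
qed

lemma two_power_sums_prod:
  assumes "finite A"
  shows "two_power_sums (\<Prod>a\<in>A. [:1, a:] ^ c a) (\<Sum>a\<in>A. a * int (c a)) (\<Sum>a\<in>A. a\<^sup>2 * int (c a))"
  using assms
proof (induction A rule: finite_induct)
  case empty
  show ?case by (simp add: two_power_sums_def)
next
  case (insert a A)
  then show ?case by (simp add: two_power_sums_mult two_power_sums_power)
qed

lemma dvd_prod_diff:
  fixes f g :: "'b \<Rightarrow> 'a::comm_ring_1"
  assumes "\<And>i. i \<in> A \<Longrightarrow> d dvd f i - g i"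
  shows "d dvd prod f A - prod g A"
  using assms
proof (induction A rule: infinite_finite_induct)
  case (insert i A)
  have "prod f (insert i A) - prod g (insert i A)
      = (f i - g i) * prod f A + g i * (prod f A - prod g A)"
    using insert by (simp add: algebra_simps)
  then show ?case using insert by simp
qed auto

lemma dvd_power_diff:
  fixes f g :: "'a::comm_ring_1"
  assumes "d dvd f - g"
  shows "d dvd f ^ n - g ^ n"
  using dvd_prod_diff[of "{..<n}" d "\<lambda>_. f" "\<lambda>_. g"] assms by simp

section \<open>Frobenius and Newton on balanced vectors\<close>

context prime_vectors
begin

text \<open>The inner binomial coefficients vanish modulo \<open>p\<close>, and Fermat replaces the
  top coefficient \<open>a ^ p\<close> by \<open>a\<close>.\<close>

lemma frobenius_linear: "[:int p:] dvd [:1, a:] ^ p - (1 + monom a p)"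
  unfolding const_poly_dvd_iff
proof
  fix j
  consider "j = 0" | "0 < j" "j < p" | "j = p" | "j > p" by linarith
  then show "int p dvd coeff ([:1, a:] ^ p - (1 + monom a p)) j"
  proof cases
    case 1
    then show ?thesis using p_pos by (simp add: coeff_linear_poly_power)
  next
    case 2
    then have "p dvd (p choose j)" using prime_p p_pos by (intro dvd_choose_prime) auto
    then show ?thesis using 2
      by (simp add: coeff_linear_poly_power)
  next
    case 3
    then show ?thesis using p_pos fermat_int_pow_p[of a] by (simp add: coeff_linear_poly_power)
  next
    case 4
    have "degree ([:1, a:] ^ p) \<le> p"
      using degree_power_le[of "[:1, a:]" p] by (simp split: if_splits)
    with 4 have "coeff ([:1, a:] ^ p) j = 0" by (intro coeff_eq_0) simp
    then show ?thesis using 4 by simp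
  qed
qed

text \<open>With Q the product of the \<open>[:1, a:] ^ q a\<close>, Frobenius makes the larger
  product congruent to Q(t^p), whose coefficient at \<open>p * k\<close> is that of Q at
  \<open>k\<close>.\<close>

lemma coeff_prod_frobenius:
  "int p dvd coeff (\<Prod>a\<in>A. [:1, a:] ^ (p * q a)) (p * k) - coeff (\<Prod>a\<in>A. [:1, a:] ^ q a) k"
proof -
  have "[:int p:] dvd (\<Prod>a\<in>A. ([:1, a:] ^ p) ^ q a) - (\<Prod>a\<in>A. (1 + monom a p) ^ q a)"
    by (intro dvd_prod_diff dvd_power_diff frobenius_linear)
  then have *: "int p dvd coeff ((\<Prod>a\<in>A. ([:1, a:] ^ p) ^ q a) - (\<Prod>a\<in>A. (1 + monom a p) ^ q a)) (p * k)"
    unfolding const_poly_dvd_iff by blast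
  have "pcompose [:1, a:] (monom 1 p) = 1 + monom a p" for a :: int
    by (simp add: pcompose_pCons one_pCons mult.commute[of "monom 1 p"] smult_monom)
  then have "(\<Prod>a\<in>A. (1 + monom a p) ^ q a) = pcompose (\<Prod>a\<in>A. [:1, a:] ^ q a) (monom 1 p)"
    by (simp add: pcompose_prod pcompose_power)
  then have "coeff (\<Prod>a\<in>A. (1 + monom a p) ^ q a) (p * k) = coeff (\<Prod>a\<in>A. [:1, a:] ^ q a) k"
    using p_pos by (simp add: coeff_pcompose_monom)
  with * show ?thesis by (simp add: power_mult)
qed

text \<open>Coordinates are grouped by value in the generating function; those equal to 0 contribute
  the factor 1.\<close>

lemma esym_level_count:
  assumes "x \<in> X"
  shows "esym d x = coeff (\<Prod>a\<in>{1..<int p}. [:1, a:] ^ level_count a x) d"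
proof -
  have "(\<Prod>i\<in>{0..<N}. [:1, x i:]) = (\<Prod>a\<in>{0..<int p}. \<Prod>i\<in>{i\<in>{0..<N}. x i = a}. [:1, x i:])"
    by (rule prod.group[symmetric]) (use coord_range[OF assms] in auto)
  also have "\<dots> = (\<Prod>a\<in>{0..<int p}. [:1, a:] ^ level_count a x)"
    by (intro prod.cong refl) (simp add: level_count_def)
  also have "{0..<int p} = insert 0 {1..<int p}" using p_pos by auto
  also have "(\<Prod>a\<in>insert 0 {1..<int p}. [:1, a:] ^ level_count a x)
      = (\<Prod>a\<in>{1..<int p}. [:1, a:] ^ level_count a x)"
    by (subst prod.insert) (auto simp: one_pCons[symmetric])
  finally show ?thesis by (simp add: esym_def coeff_prod_linear[symmetric])
qed

lemma sum_level_count: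
  assumes "x \<in> X"
  shows "(\<Sum>i\<in>{0..<N}. x i) = (\<Sum>a\<in>{1..<int p}. a * int (level_count a x))"
proof -
  have "(\<Sum>i\<in>{0..<N}. x i) = (\<Sum>a\<in>{0..<int p}. \<Sum>i\<in>{i\<in>{0..<N}. x i = a}. x i)"
    by (rule sum.group[symmetric]) (use coord_range[OF assms] in auto)
  also have "\<dots> = (\<Sum>a\<in>{0..<int p}. a * int (level_count a x))"
    by (intro sum.cong refl) (simp add: level_count_def)
  also have "{0..<int p} = insert 0 {1..<int p}" using p_pos by auto
  finally show ?thesis by simp
qed

definition balanced :: "(nat \<Rightarrow> int) set" where
  "balanced = {x\<in>X. (\<forall>a\<in>{1..<int p}. p dvd level_count a x) \<and> int p ^ 2 dvd (\<Sum>i\<in>{0..<N}. x i)}"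

text \<open>The generating function is the \<open>p\<close>-th power of \<open>Q\<close>, and both
  terms are congruent to \<open>p * coeff Q 2\<close> modulo \<open>p^2\<close>: the first by
  Frobenius, the second by Newton's identity.\<close>

lemma esym_balanced:
  assumes "x \<in> balanced"
  shows "int p ^ 2 dvd int p * esym (2 * p) x - esym 2 x"
proof -
  have x: "x \<in> X" and L: "int p ^ 2 dvd (\<Sum>i\<in>{0..<N}. x i)"
    and "\<forall>a\<in>{1..<int p}. \<exists>q. level_count a x = p * q"
    using assms by (auto simp: balanced_def dvd_def)
  then obtain q where q: "\<And>a. a \<in> {1..<int p} \<Longrightarrow> level_count a x = p * q a" by metis
  define A where "A = {1..<int p}"
  define Q where "Q = (\<Prod>a\<in>A. [:1, a:] ^ q a)"
  define s where "s = (\<Sum>a\<in>A. a * int (q a))"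
  define r where "r = (\<Sum>a\<in>A. a\<^sup>2 * int (q a))"
  have esym: "esym d x = coeff (\<Prod>a\<in>A. [:1, a:] ^ (p * q a)) d" for d
    unfolding esym_level_count[OF x] A_def by (simp add: q)
  have "two_power_sums (\<Prod>a\<in>A. [:1, a:] ^ (p * q a)) (int p * s) (int p * r)"
    using two_power_sums_prod[of A "\<lambda>a. p * q a"]
    by (simp add: A_def s_def r_def sum_distrib_left mult.left_commute)
  then have e2: "2 * esym 2 x = (int p * s)\<^sup>2 - int p * r"
    by (simp add: two_power_sums_def esym)
  have "two_power_sums Q s r"
    unfolding Q_def s_def r_def by (intro two_power_sums_prod) (simp add: A_def)
  then have Q2: "2 * coeff Q 2 = s\<^sup>2 - r" by (simp add: two_power_sums_def)
  have "(\<Sum>i\<in>{0..<N}. x i) = int p * s"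
    unfolding sum_level_count[OF x] s_def A_def by (simp add: q sum_distrib_left mult.left_commute)
  with L have ps: "int p dvd s" using p_pos by (simp add: power2_eq_square)
  define Y where "Y = int p * coeff Q 2 - esym 2 x"
  have "2 * Y = int p * (2 * coeff Q 2) - 2 * esym 2 x" by (simp add: Y_def)
  \<comment> \<open>The \<open>r\<close> terms cancel; what remains is small because the condition
    on the coordinate sum makes \<open>s\<close> divisible by \<open>p\<close>.\<close>
  also have "\<dots> = int p * s\<^sup>2 * (1 - int p)" unfolding Q2 e2 by (simp add: power2_eq_square algebra_simps)
  also have "int p ^ 3 dvd \<dots>"
    using dvd_power_same[OF ps, of 2]
    by - (rule dvd_mult2, simp add: power3_eq_cube power2_eq_square)
  finally have "int p ^ 3 dvd 2 * Y" .
  have Y: "int p ^ 2 dvd Y"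
  proof (cases "p = 2")
    case True
    with \<open>int p ^ 3 dvd 2 * Y\<close> show ?thesis by (auto simp: power2_eq_square power3_eq_cube)
  next
    case False
    then have "odd p" using prime_p prime_odd_nat[of p] p_gt_1 by linarith
    then have "coprime (int p ^ 2) 2" by simp
    moreover have "int p ^ 2 dvd 2 * Y"
      using \<open>int p ^ 3 dvd 2 * Y\<close> by (rule power_le_dvd) simp
    ultimately show ?thesis by (simp add: coprime_dvd_mult_right_iff)
  qed
  have "int p dvd esym (2 * p) x - coeff Q 2"
    using coeff_prod_frobenius[where A=A and q=q and k=2] by (simp add: esym Q_def mult.commute)
  then have "int p ^ 2 dvd int p * (esym (2 * p) x - coeff Q 2)"
    by (simp add: power2_eq_square)
  from dvd_add[OF this Y] show ?thesis by (simp add: Y_def algebra_simps)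
qed

end

subsection \<open>Characters and Gowers norms\<close>

lemma echar_add: "echar m (a + b) = echar m a * echar m b"
  by (simp add: echar_def exp_add[symmetric] add_divide_distrib algebra_simps)

lemma cnj_echar: "cnj (echar m a) = echar m (- a)"
  by (simp add: echar_def exp_cnj)

lemma echar_0 [simp]: "echar m 0 = 1"
  by (simp add: echar_def)

lemma echar_diff: "echar m (a - b) = echar m a * cnj (echar m b)"
  using echar_add[of m a "- b"] by (simp add: cnj_echar)

lemma echar_of_nat_mult: "echar m (int t * a) = echar m a ^ t"
  by (induction t) (auto simp: echar_add algebra_simps)

lemma echar_eq_1_iff:
  assumes "m > 0"
  shows "echar m a = 1 \<longleftrightarrow> int m dvd a"
proof -
  have "echar m a = 1 \<longleftrightarrow> (\<exists>n::int. real_of_int a = real_of_int (int m * n))"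
    unfolding echar_def exp_eq_1 using assms by (simp add: field_simps)
  also have "\<dots> \<longleftrightarrow> int m dvd a"
    unfolding of_int_eq_iff dvd_def ..
  finally show ?thesis .
qed

lemma echar_cong_mod: "m > 0 \<Longrightarrow> echar m (a mod int m) = echar m a"
  using echar_add[of m "a mod int m" "int m * (a div int m)"] echar_eq_1_iff[of m "int m * (a div int m)"]
  by simp

lemma echar_square: "m > 0 \<Longrightarrow> echar (m\<^sup>2) (int m * a) = echar m a"
  by (simp add: echar_def power2_eq_square mult.assoc)

text \<open>Orthogonality of the characters of the integers modulo \<open>m\<close>: a geometric sum
  over a root of unity.\<close>

lemma sum_echar:
  assumes "m > 0"
  shows "(\<Sum>t<m. echar m (int t * a)) = (if int m dvd a then of_nat m else 0)"
proof (cases "int m dvd a")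
  case True
  then have "echar m a = 1" using assms by (simp add: echar_eq_1_iff)
  then show ?thesis using True by (simp add: echar_of_nat_mult)
next
  case False
  have "echar m a ^ m = 1"
    using echar_eq_1_iff[OF assms, of "int m * a"] by (simp add: echar_of_nat_mult)
  then show ?thesis using False assms
    by (simp add: echar_of_nat_mult echar_eq_1_iff sum_gp_strict)
qed

text \<open>Cauchy-Schwarz applied \<open>k\<close> times.\<close>

lemma power_mean_pow2:
  fixes a :: "'a \<Rightarrow> real"
  assumes "finite A" "\<And>i. i \<in> A \<Longrightarrow> a i \<ge> 0"
  shows "((\<Sum>i\<in>A. a i) / card A) ^ (2 ^ k) \<le> (\<Sum>i\<in>A. a i ^ (2 ^ k)) / card A"
proof (induction k)
  case (Suc k)
  have "((\<Sum>i\<in>A. a i) / card A) ^ (2 ^ Suc k) = (((\<Sum>i\<in>A. a i) / card A) ^ (2 ^ k))\<^sup>2"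
    by (simp add: power_mult[symmetric] mult.commute)
  also have "\<dots> \<le> ((\<Sum>i\<in>A. a i ^ (2 ^ k)) / card A)\<^sup>2"
    by (intro power_mono Suc.IH zero_le_power divide_nonneg_nonneg sum_nonneg assms) auto
  also have "\<dots> = (\<Sum>i\<in>A. a i ^ (2 ^ k))\<^sup>2 / (card A)\<^sup>2" by (simp add: power_divide)
  also have "\<dots> \<le> ((\<Sum>i\<in>A. (a i ^ (2 ^ k))\<^sup>2) * card A) / (card A)\<^sup>2"
    by (intro divide_right_mono sum_squared_le_sum_of_squares) auto
  also have "\<dots> = (\<Sum>i\<in>A. a i ^ (2 ^ Suc k)) / card A"
    by (simp add: power_mult[symmetric] power2_eq_square[of "real (card A)"] mult.commute[of _ 2])
  finally show ?case .
qed simp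

lemma finite_Fvec: "finite (Fvec p N)"
proof -
  have "Fvec p N = {f. \<forall>i. (i \<in> {..<N} \<longrightarrow> f i \<in> {0..<int p}) \<and> (i \<notin> {..<N} \<longrightarrow> f i = 0)}"
    unfolding Fvec_def by (auto simp: not_less)
  also have "finite \<dots>" by (rule finite_set_of_finite_funs) auto
  finally show ?thesis .
qed

section \<open>Multiplicative derivatives and Gowers averages\<close>

context prime_vectors
begin

lemma zero_in: "(\<lambda>_. 0) \<in> X"
  using p_pos by (simp add: Fvec_def)

lemma card_X_pos: "card X > 0"
  using zero_in finite_Fvec card_gt_0_iff by blast

lemma bij_vadd: "x \<in> X \<Longrightarrow> bij_betw (vadd p x) X X"
proof -
  assume x: "x \<in> X"
  have "inj_on (vadd p x) X"
  proof (rule inj_onI, rule ext)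
    fix y z i assume "y \<in> X" "z \<in> X" "vadd p x y = vadd p x z"
    then have "(x i + y i) mod int p = (x i + z i) mod int p" by (metis vadd_def)
    then have "int p dvd y i - z i" by (simp add: mod_eq_dvd_iff)
    then show "y i = z i" using coord_range[OF \<open>y \<in> X\<close>, of i] coord_range[OF \<open>z \<in> X\<close>, of i]
      by (metis atLeastLessThan_iff mod_eq_dvd_iff mod_pos_pos_trivial)
  qed
  moreover have "vadd p x ` X \<subseteq> X" using x by auto
  ultimately show ?thesis
    unfolding bij_betw_def using endo_inj_surj[OF finite_Fvec] by blast
qed

definition mdiff :: "(nat \<Rightarrow> int) \<Rightarrow> ((nat \<Rightarrow> int) \<Rightarrow> complex) \<Rightarrow> (nat \<Rightarrow> int) \<Rightarrow> complex" where
  "mdiff y F = (\<lambda>x. F (vadd p x y) * cnj (F x))"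

definition mean :: "((nat \<Rightarrow> int) \<Rightarrow> complex) \<Rightarrow> complex" where
  "mean F = (\<Sum>x\<in>X. F x) / of_nat (card X)"

text \<open>The \<open>2^k\<close>-th power of the Gowers norm, for arbitrary complex functions; the
  recursive form serves the inductions.\<close>

primrec gowers :: "nat \<Rightarrow> ((nat \<Rightarrow> int) \<Rightarrow> complex) \<Rightarrow> complex" where
  "gowers 0 F = mean F"
| "gowers (Suc k) F = mean (\<lambda>y. gowers k (mdiff y F))"

text \<open>For fixed \<open>x\<close> the shift by \<open>x\<close> permutes \<open>X\<close>, so
  the double sum factors.\<close>

lemma mean_mdiff: "mean (\<lambda>y. mean (mdiff y F)) = of_real ((cmod (mean F))\<^sup>2)"
proof -
  have "(\<Sum>y\<in>X. \<Sum>x\<in>X. mdiff y F x) = (\<Sum>x\<in>X. (\<Sum>y\<in>X. F (vadd p x y)) * cnj (F x))"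
    by (subst sum.swap) (simp add: mdiff_def sum_distrib_right)
  also have "\<dots> = (\<Sum>x\<in>X. (\<Sum>y\<in>X. F y) * cnj (F x))"
    by (intro sum.cong refl) (simp add: sum.reindex_bij_betw[OF bij_vadd])
  also have "\<dots> = (\<Sum>y\<in>X. F y) * cnj (\<Sum>y\<in>X. F y)"
    by (simp add: sum_distrib_left)
  finally show ?thesis
    by (simp add: mean_def sum_divide_distrib[symmetric] complex_norm_square del: of_real_power)
qed

text \<open>The norms dominate the mean: \<open>mean_mdiff\<close> rewrites the squared mean as an
  average over directions, the power mean inequality moves the exponent inside, and induction treats
  each derivative.\<close>

lemma gowers_ge: "Re (gowers (Suc k) F) \<ge> cmod (mean F) ^ (2 ^ Suc k)"
proof (induction k arbitrary: F)
  case 0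
  then show ?case by (simp add: mean_mdiff)
next
  case (Suc k)
  have "cmod (mean F) ^ (2 ^ Suc (Suc k)) = (cmod (mean (\<lambda>y. mean (mdiff y F)))) ^ (2 ^ Suc k)"
    by (simp add: mean_mdiff norm_power power_mult[symmetric])
  also have "\<dots> \<le> ((\<Sum>y\<in>X. cmod (mean (mdiff y F))) / card X) ^ (2 ^ Suc k)"
    unfolding mean_def[of "\<lambda>y. mean (mdiff y F)"]
    by (intro power_mono) (auto simp: norm_divide intro!: divide_right_mono norm_sum)
  also have "\<dots> \<le> (\<Sum>y\<in>X. cmod (mean (mdiff y F)) ^ (2 ^ Suc k)) / card X"
    by (intro power_mean_pow2 finite_Fvec) auto
  also have "\<dots> \<le> (\<Sum>y\<in>X. Re (gowers (Suc k) (mdiff y F))) / card X"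
    by (intro divide_right_mono sum_mono Suc.IH) auto
  also have "\<dots> = Re (gowers (Suc (Suc k)) F)"
    unfolding gowers.simps(2)[of "Suc k"] mean_def[of "\<lambda>y. gowers (Suc k) (mdiff y F)"]
    by (simp add: Re_divide_of_nat del: gowers.simps)
  finally show ?case .
qed

text \<open>Each multiplicative derivative turns the phase of \<open>u\<close> into that of
  \<open>diff y u\<close>; after \<open>k\<close> of them the phase is 1.\<close>

lemma gowers_mult_phase:
  assumes "annih k m u" "m > 0"
  shows "gowers k (\<lambda>x. F x * echar m (u x)) = gowers k F"
  using assms
proof (induction k arbitrary: F u)
  case 0
  then have "(\<Sum>x\<in>X. F x * echar m (u x)) = (\<Sum>x\<in>X. F x)"
    by (intro sum.cong refl) (simp add: echar_eq_1_iff)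
  then show ?case by (simp add: mean_def)
next
  case (Suc k)
  have "mdiff y (\<lambda>x. F x * echar m (u x)) = (\<lambda>x. mdiff y F x * echar m (diff y u x))" for y
    by (auto simp: mdiff_def diff_def echar_diff)
  then show ?case using Suc by (simp add: mean_def)
qed

lemma gowers_foldl:
  "gowers k F = (\<Sum>x\<in>X. \<Sum>ys\<in>{ys. length ys = k \<and> set ys \<subseteq> X}. foldl (\<lambda>G y. mdiff y G) F ys x)
     / of_nat (card X ^ (k + 1))"
proof (induction k arbitrary: F)
  case 0
  have "{ys. length ys = 0 \<and> set ys \<subseteq> X} = {[]}" by auto
  then show ?case by (simp add: mean_def)
next
  case (Suc k)
  let ?L = "\<lambda>k. {ys. length ys = k \<and> set ys \<subseteq> X}"
  have "(\<Sum>ys\<in>?L (Suc k). foldl (\<lambda>G y. mdiff y G) F ys x)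
      = (\<Sum>(y,ys)\<in>X \<times> ?L k. foldl (\<lambda>G y. mdiff y G) (mdiff y F) ys x)" for x
    by (rule sum.reindex_bij_witness[of _ "\<lambda>(y,ys). y # ys" "\<lambda>ys. (hd ys, tl ys)"])
      (auto simp: length_Suc_conv)
  then have "(\<Sum>x\<in>X. \<Sum>ys\<in>?L (Suc k). foldl (\<lambda>G y. mdiff y G) F ys x)
      = (\<Sum>y\<in>X. \<Sum>x\<in>X. \<Sum>ys\<in>?L k. foldl (\<lambda>G y. mdiff y G) (mdiff y F) ys x)"
    by (simp add: sum.cartesian_product[symmetric]) (rule sum.swap)
  then show ?case
    by (simp add: Suc.IH mean_def sum_divide_distrib[symmetric] divide_divide_eq_left mult.commute mult.left_commute)
qed

lemma echar_iter_deriv: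
  "echar p (iter_deriv p f ys x) = foldl (\<lambda>G y. mdiff y G) (\<lambda>x. echar p (f x)) ys x"
proof (induction ys arbitrary: f)
  case Nil
  show ?case by (simp add: iter_deriv_def)
next
  case (Cons y ys)
  have "(\<lambda>x. echar p (dderiv p f y x)) = mdiff y (\<lambda>x. echar p (f x))"
    using p_pos by (auto simp: dderiv_def mdiff_def echar_cong_mod echar_diff)
  then show ?case using Cons[of "dderiv p f y"] by (simp add: iter_deriv_def)
qed

lemma gowers_norm_eq:
  "gowers_norm p N k f = Re (gowers k (\<lambda>x. echar p (f x))) powr (1 / 2 ^ k)"
  unfolding gowers_norm_def gowers_foldl echar_iter_deriv ..

text \<open>Fourier expansion of the indicator of \<open>{x. \<forall>w\<in>W. m dvd w x}\<close>, keeping the largest term.\<close>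

lemma exists_correlating_phase:
  assumes "finite W" "\<And>w. w \<in> W \<Longrightarrow> annih k m w" "m > 0"
  shows "\<exists>u. annih k m u \<and>
    cmod (\<Sum>x\<in>{x\<in>X. \<forall>w\<in>W. int m dvd w x}. F x) \<le> cmod (\<Sum>x\<in>X. F x * echar m (u x))"
  using assms
proof (induction W arbitrary: F rule: finite_induct)
  case empty
  show ?case by (rule exI[of _ "\<lambda>_. 0"]) (simp add: annih_zero)
next
  case (insert w W)
  \<comment> \<open>One condition is absorbed into the function, which is why the induction keeps
    \<open>F\<close> arbitrary.\<close>
  define G where "G = (\<lambda>x. if int m dvd w x then F x else 0)"
  obtain u where u: "annih k m u"
    "cmod (\<Sum>x\<in>{x\<in>X. \<forall>w\<in>W. int m dvd w x}. G x) \<le> cmod (\<Sum>x\<in>X. G x * echar m (u x))"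
    using insert.IH[of G] insert.prems by auto
  have "(\<Sum>x\<in>{x\<in>X. \<forall>w\<in>W. int m dvd w x}. G x) = (\<Sum>x\<in>{x\<in>X. \<forall>w\<in>insert w W. int m dvd w x}. F x)"
    unfolding G_def by (subst sum.inter_filter[symmetric]) (auto intro!: sum.cong simp: finite_Fvec)
  note u' = u(2)[unfolded this]
  define H where "H = (\<lambda>t. \<Sum>x\<in>X. F x * echar m (u x + int t * w x))"
  have "(\<Sum>t<m. H t) = (\<Sum>x\<in>X. F x * echar m (u x) * (\<Sum>t<m. echar m (int t * w x)))"
    unfolding H_def by (subst sum.swap) (simp add: echar_add sum_distrib_left mult.assoc)
  also have "\<dots> = (\<Sum>x\<in>X. of_nat m * (G x * echar m (u x)))"
    using insert.prems by (intro sum.cong refl) (auto simp: sum_echar G_def)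
  finally have sumH: "(\<Sum>t<m. H t) = of_nat m * (\<Sum>x\<in>X. G x * echar m (u x))"
    by (simp add: sum_distrib_left)
  \<comment> \<open>The sum over \<open>G\<close> is the average of the \<open>m\<close> values
    \<open>H t\<close>, so one of them is at least as large in modulus.\<close>
  have "\<exists>t<m. cmod (\<Sum>x\<in>X. G x * echar m (u x)) \<le> cmod (H t)"
  proof (rule ccontr)
    assume "\<not> ?thesis"
    then have "(\<Sum>t<m. cmod (H t)) < (\<Sum>t<m. cmod (\<Sum>x\<in>X. G x * echar m (u x)))"
      using insert.prems by (intro sum_strict_mono) auto
    moreover have "cmod (\<Sum>t<m. H t) \<le> (\<Sum>t<m. cmod (H t))" by (rule norm_sum)
    ultimately show False by (simp add: sumH norm_mult)
  qed
  then obtain t where t: "cmod (\<Sum>x\<in>X. G x * echar m (u x)) \<le> cmod (H t)" by blast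
  have "annih k m (\<lambda>x. u x + int t * w x)"
    using insert.prems u(1) by (intro annih_add annih_cmult) auto
  moreover have "cmod (\<Sum>x\<in>{x\<in>X. \<forall>w\<in>insert w W. int m dvd w x}. F x)
      \<le> cmod (\<Sum>x\<in>X. F x * echar m (u x + int t * w x))"
    using u' t unfolding H_def by linarith
  ultimately show ?case by blast
qed

end

subsection \<open>Density of the balanced vectors\<close>

context prime_vectors
begin

text \<open>The first \<open>(p - 1) * p^2\<close> coordinates form \<open>p - 1\<close> blocks of
  length \<open>p^2\<close>, one per nonzero value. Each block receives enough copies of its value
  to correct the count of that value, and zeros elsewhere.\<close>

lemma exists_balanced_extension:
  assumes x: "x \<in> X" and K: "(p - 1) * p\<^sup>2 \<le> N"
  shows "\<exists>y\<in>balanced. \<forall>i\<ge>(p - 1) * p\<^sup>2. y i = x i"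
proof -
  define K where "K = (p - 1) * p\<^sup>2"
  define r where "r = (\<lambda>b. card {i\<in>{K..<N}. x i = int b})"
  \<comment> \<open>The number of copies still missing modulo \<open>p^2\<close>; being less than
    \<open>p^2\<close>, it fits into one block.\<close>
  define s where "s = (\<lambda>b. nat ((- int (r b)) mod int (p\<^sup>2)))"
  define y where "y = (\<lambda>i. if i < K then if i mod p\<^sup>2 < s (i div p\<^sup>2 + 1) then int (i div p\<^sup>2 + 1) else 0 else x i)"
  have p2: "p\<^sup>2 > 0" using p_pos by simp
  have s_less: "s b < p\<^sup>2" for b
    using p2 by (simp add: s_def nat_less_iff del: of_nat_power)
  have sr: "p\<^sup>2 dvd s b + r b" for b
  proof -
    have "int (s b + r b) = (- int (r b)) mod int (p\<^sup>2) + int (r b)"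
      using p2 by (simp add: s_def del: of_nat_power)
    then have "int (p\<^sup>2) dvd int (s b + r b)"
      by (metis add.commute add.right_inverse dvd_eq_mod_eq_0 mod_0 mod_add_right_eq)
    then show ?thesis by (simp only: int_dvd_int_iff)
  qed
  have div_less: "i div p\<^sup>2 < p - 1" if "i < K" for i
    using that by (simp add: K_def less_mult_imp_div_less)
  have y: "y \<in> X"
    using x K div_less unfolding Fvec_def y_def K_def[symmetric] by (fastforce simp: K_def[symmetric])
  have count: "p\<^sup>2 dvd level_count a y" if a: "a \<in> {1..<int p}" for a
  proof -
    obtain b where b: "a = int (Suc b)" "Suc b < p" 
      using a by (intro that[of "nat a - 1"]) auto
    have "{i\<in>{0..<N}. y i = a} = (\<lambda>t. b * p\<^sup>2 + t) ` {..<s (Suc b)} \<union> {i\<in>{K..<N}. x i = a}"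
    proof (intro equalityI subsetI)
      fix i assume i: "i \<in> {i\<in>{0..<N}. y i = a}"
      show "i \<in> (\<lambda>t. b * p\<^sup>2 + t) ` {..<s (Suc b)} \<union> {i\<in>{K..<N}. x i = a}"
      proof (cases "i < K")
        case True
        then have "i div p\<^sup>2 = b" "i mod p\<^sup>2 < s (Suc b)"
          using i b(1) by (auto simp: y_def split: if_splits)
        then have "i = b * p\<^sup>2 + i mod p\<^sup>2" by (metis div_mult_mod_eq)
        then show ?thesis using \<open>i mod p\<^sup>2 < s (Suc b)\<close> by blast
      qed (use i in \<open>auto simp: y_def\<close>)
    next
      fix i assume "i \<in> (\<lambda>t. b * p\<^sup>2 + t) ` {..<s (Suc b)} \<union> {i\<in>{K..<N}. x i = a}"
      then show "i \<in> {i\<in>{0..<N}. y i = a}"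
      proof
        assume "i \<in> (\<lambda>t. b * p\<^sup>2 + t) ` {..<s (Suc b)}"
        then obtain t where t: "i = b * p\<^sup>2 + t" "t < s (Suc b)" by blast
        with s_less[of "Suc b"] have "t < p\<^sup>2" by linarith
        then have dm: "i div p\<^sup>2 = b" "i mod p\<^sup>2 = t" using t p2 by (auto simp: div_mult_self3)
        have "i < Suc b * p\<^sup>2" using t(1) \<open>t < p\<^sup>2\<close> by simp
        also have "\<dots> \<le> K" unfolding K_def using b(2) by (intro mult_le_mono1) simp
        finally have "i < K" .
        moreover have "i < N" using \<open>i < K\<close> K by (simp add: K_def)
        ultimately show ?thesis using dm t(2) b(1) by (simp add: y_def)
      qed (auto simp: y_def)
    qed
    moreover have "(\<lambda>t. b * p\<^sup>2 + t) ` {..<s (Suc b)} \<inter> {i\<in>{K..<N}. x i = a} = {}"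
    proof -
      have "b * p\<^sup>2 + t < K" if "t < s (Suc b)" for t
      proof -
        have "b * p\<^sup>2 + t < Suc b * p\<^sup>2" using that s_less[of "Suc b"] by simp
        also have "\<dots> \<le> K" unfolding K_def using b(2) by (intro mult_le_mono1) simp
        finally show ?thesis .
      qed
      then show ?thesis by fastforce
    qed
    ultimately have "level_count a y = card ((\<lambda>t. b * p\<^sup>2 + t) ` {..<s (Suc b)}) + r (Suc b)"
      by (simp add: level_count_def r_def card_Un_disjoint b(1))
    also have "card ((\<lambda>t. b * p\<^sup>2 + t) ` {..<s (Suc b)}) = s (Suc b)"
      by (simp add: card_image inj_on_def)
    finally show ?thesis using sr by simp
  qed
  \<comment> \<open>Counts were corrected modulo \<open>p^2\<close> rather than \<open>p\<close> so
    that the coordinate sum is divisible by \<open>p^2\<close> as well.\<close>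
  have "int p ^ 2 dvd (\<Sum>i\<in>{0..<N}. y i)"
    unfolding sum_level_count[OF y] using count
    by (intro dvd_sum dvd_mult) (metis int_dvd_int_iff of_nat_power)
  moreover have "p dvd level_count a y" if "a \<in> {1..<int p}" for a
    using count[OF that] by (metis dvd_mult_left power2_eq_square)
  ultimately have "y \<in> balanced" using y by (simp add: balanced_def)
  moreover have "\<forall>i\<ge>K. y i = x i" by (simp add: y_def)
  ultimately show ?thesis unfolding K_def by blast
qed

text \<open>A vector is determined by its balanced modification together with its overwritten
  initial coordinates, so the density of \<open>balanced\<close> is bounded below independently of
  \<open>N\<close>.\<close>

lemma card_balanced: "card X \<le> card (Fvec p ((p - 1) * p\<^sup>2)) * card balanced"
proof -
  define K where "K = (p - 1) * p\<^sup>2"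
  have fin: "finite balanced" using finite_Fvec[of p N] by (simp add: balanced_def)
  show ?thesis
  proof (cases "K \<le> N")
    \<comment> \<open>In small dimension the zero vector alone suffices, as \<open>X\<close> embeds
      in the larger space.\<close>
    case False
    have "X \<subseteq> Fvec p K"
    proof
      fix x assume x: "x \<in> X"
      then have "\<forall>i\<ge>N. x i = 0" by (simp add: Fvec_def)
      with False have "\<forall>i\<ge>K. x i = 0" by simp
      then show "x \<in> Fvec p K" using coord_range[OF x] unfolding Fvec_def by blast
    qed
    then have "card X \<le> card (Fvec p K)" by (intro card_mono finite_Fvec)
    moreover have "(\<lambda>_. 0) \<in> balanced"
      using zero_in by (simp add: balanced_def level_count_def)
    then have "card balanced > 0" using fin card_gt_0_iff by blast
    ultimately show ?thesis unfolding K_def[symmetric]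
      by (metis One_nat_def Suc_leI le_trans mult.right_neutral mult_le_mono2)
  next
    case True
    then obtain g where g: "\<And>x. x \<in> X \<Longrightarrow> g x \<in> balanced" "\<And>x i. x \<in> X \<Longrightarrow> i \<ge> K \<Longrightarrow> g x i = x i"
      using exists_balanced_extension unfolding K_def by metis
    define h where "h = (\<lambda>x. (\<lambda>i. if i < K then x i else 0 :: int, g x))"
    have "inj_on h X"
    proof (rule inj_onI, rule ext)
      fix x y i assume *: "x \<in> X" "y \<in> X" "h x = h y"
      show "x i = y i"
      proof (cases "i < K")
        case True
        from * have "(\<lambda>i. if i < K then x i else 0) i = (\<lambda>i. if i < K then y i else 0) i"
          unfolding h_def prod.inject by metis
        with True show ?thesis by simp
      next
        case False
        with * g(2)[of x i] g(2)[of y i] show ?thesis by (simp add: h_def)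
      qed
    qed
    moreover have "h ` X \<subseteq> Fvec p K \<times> balanced"
      using True g(1) by (auto simp: h_def Fvec_def)
    ultimately have "card X \<le> card (Fvec p K \<times> balanced)"
      using fin finite_Fvec by (intro card_inj_on_le) auto
    then show ?thesis by (simp add: K_def card_cartesian_product)
  qed
qed

section \<open>The lower bound for the norm\<close>

lemma gowers_norm_esym_ge:
  "gowers_norm p N (p + 2) (elem_sym p N (2 * p)) \<ge> 1 / card (Fvec p ((p - 1) * p\<^sup>2))"
proof -
  define C where "C = card (Fvec p ((p - 1) * p\<^sup>2))"
  define F where "F = (\<lambda>x. echar p (elem_sym p N (2 * p) x))"
  \<comment> \<open>Dividing out the phase of \<open>esym 2\<close> makes the function equal to 1 on
    \<open>balanced\<close>, so its sum there is the cardinality.\<close>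
  define G where "G = (\<lambda>x. F x * echar (p\<^sup>2) (- 1 * esym 2 x))"
  define W where "W = insert (\<lambda>x. \<Sum>i\<in>{0..<N}. x i) ((\<lambda>a x. int p * int (level_count a x)) ` {1..<int p})"
  have C: "C > 0"
    unfolding C_def using finite_Fvec[of p] prime_vectors.zero_in[of p] prime_p
    by (metis card_gt_0_iff empty_iff prime_vectors.intro)
  have p2: "p\<^sup>2 > 0" using p_pos by simp
  have F: "F x = echar (p\<^sup>2) (int p * esym (2 * p) x)" for x
    using p_pos by (simp add: F_def elem_sym_def esym_def echar_cong_mod echar_square)
  have G_balanced: "G x = 1" if "x \<in> balanced" for x
  proof -
    have "G x = echar (p\<^sup>2) (int p * esym (2 * p) x - esym 2 x)"
      unfolding G_def F using echar_add[of "p\<^sup>2" "int p * esym (2 * p) x" "- esym 2 x"] by simp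
    then show ?thesis using esym_balanced[OF that] p2 by (simp add: echar_eq_1_iff)
  qed
  have W: "annih (p + 2) (p\<^sup>2) w" if "w \<in> W" for w
    using that annih_coord_sum annih_level_count unfolding W_def by auto
  have bal: "{x\<in>X. \<forall>w\<in>W. int (p\<^sup>2) dvd w x} = balanced"
    using p_pos unfolding W_def balanced_def by (auto simp: power2_eq_square)
  obtain u where u: "annih (p + 2) (p\<^sup>2) u"
    "cmod (\<Sum>x\<in>balanced. G x) \<le> cmod (\<Sum>x\<in>X. G x * echar (p\<^sup>2) (u x))"
    using exists_correlating_phase[of W "p + 2" "p\<^sup>2" G] W p2 unfolding bal by (auto simp: W_def)
  have "1 / C \<le> card balanced / card X"
  proof -
    have "real (card X) \<le> C * card balanced"
      using card_balanced unfolding C_def by (metis of_nat_le_iff of_nat_mult)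
    then show ?thesis using C card_X_pos by (simp add: field_simps)
  qed
  also have "\<dots> = cmod (\<Sum>x\<in>balanced. G x) / card X" by (simp add: G_balanced)
  also have "\<dots> \<le> cmod (mean (\<lambda>x. G x * echar (p\<^sup>2) (u x)))"
    unfolding mean_def norm_divide norm_of_nat using u(2) by (intro divide_right_mono) auto
  finally have mean: "1 / C \<le> cmod (mean (\<lambda>x. G x * echar (p\<^sup>2) (u x)))" .
  have "(1 / C) ^ (2 ^ (p + 2)) \<le> cmod (mean (\<lambda>x. G x * echar (p\<^sup>2) (u x))) ^ (2 ^ (p + 2))"
    using mean by (intro power_mono) auto
  also have "\<dots> \<le> Re (gowers (p + 2) (\<lambda>x. G x * echar (p\<^sup>2) (u x)))"
    using gowers_ge[where k = "p + 1"] by (simp only: Suc_eq_plus1 add.assoc one_add_one)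
  \<comment> \<open>Both \<open>u\<close> and \<open>- esym 2\<close> have degree below
    \<open>p + 2\<close>, so their phases drop out one after the other.\<close>
  also have "gowers (p + 2) (\<lambda>x. G x * echar (p\<^sup>2) (u x)) = gowers (p + 2) F"
    unfolding gowers_mult_phase[OF u(1) p2] G_def
    by (rule gowers_mult_phase[OF annih_cmult[OF annih_esym_2] p2])
  finally have "(1 / C) ^ (2 ^ (p + 2)) \<le> Re (gowers (p + 2) F)" .
  then have "((1 / C) ^ (2 ^ (p + 2))) powr (1 / 2 ^ (p + 2)) \<le> Re (gowers (p + 2) F) powr (1 / 2 ^ (p + 2))"
    by (intro powr_mono2) auto
  moreover have "((1 / C) ^ (2 ^ (p + 2))) powr (1 / 2 ^ (p + 2)) = 1 / C"
    using C by (simp add: powr_realpow[symmetric] powr_powr del: power_add)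
  ultimately show ?thesis unfolding gowers_norm_eq F_def C_def by simp
qed

end

theorem theorem1p2:
  fixes p :: nat
  assumes "prime p"
  shows "\<exists>\<epsilon>>0. \<forall>N\<ge>1. gowers_norm p N (p + 2) (elem_sym p N (2 * p)) > \<epsilon>"
proof -
  define C where "C = card (Fvec p ((p - 1) * p\<^sup>2))"
  interpret V: prime_vectors p "(p - 1) * p\<^sup>2" using assms by unfold_locales
  have C: "C > 0" using V.card_X_pos by (simp add: C_def)
  \<comment> \<open>Halving makes the inequality strict; \<open>C\<close> depends on
    \<open>p\<close> only.\<close>
  have "gowers_norm p N (p + 2) (elem_sym p N (2 * p)) > 1 / C / 2" for N
  proof -
    interpret prime_vectors p N using assms by unfold_locales
    have "1 / C / 2 < 1 / real C" using C by (simp add: field_simps)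
    also have "\<dots> \<le> gowers_norm p N (p + 2) (elem_sym p N (2 * p))"
      unfolding C_def by (rule gowers_norm_esym_ge)
    finally show ?thesis .
  qed
  moreover have "1 / real C / 2 > 0" using C by simp
  ultimately show ?thesis by blast
qed

end
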